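(* For any finite set $\mathcal{I}$ of intervals, the containment interval graph $\mathcal{C}[\mathcal{I}]$ admits a proper coloring with at most $2\,\omega(\mathcal{C}[\mathcal{I}]) - 1$ colors.
   Context: For a finite set $\mathcal{I}$ of intervals on the real line, the containment interval graph $\mathcal{C}[\mathcal{I}]$ is the mixed graph with vertex set $\mathcal{I}$ in which, for every pair of distinct intersecting intervals $u,v$: there is an arc $(u,v)$ if $u$ contains $v$, and an (undirected) edge $\{u,v\}$ if $u$ and $v$ overlap (intersect but neither contains the other). A proper coloring of a mixed graph $G$ is a function $f\colon V(G)\to\mathbb{N}$ such that $f(u)\neq f(v)$ for every edge $\{u,v\}$ and $f(u)<f(v)$ for every arc $(u,v)$; the number of colors is the number of distinct values used. $\omega(G)$ denotes the size of a largest clique in the underlying undirected graph of $G$ (which has an edge for every edge or arc of $G$). *)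

theory Defs
  imports "HOL-Analysis.Analysis"
begin

record 'a mixed_graph =
  verts :: "'a set"
  edges :: "'a set set"
  arcs  :: "('a \<times> 'a) set"

definition underlying_edges :: "'a mixed_graph \<Rightarrow> 'a set set" where
  "underlying_edges G = edges G \<union> {{u, v} | u v. (u, v) \<in> arcs G}"

definition clique :: "'a mixed_graph \<Rightarrow> 'a set \<Rightarrow> bool" where
  "clique G K \<longleftrightarrow>
     K \<subseteq> verts G \<and> (\<forall>u\<in>K. \<forall>v\<in>K. u \<noteq> v \<longrightarrow> {u, v} \<in> underlying_edges G)"

text \<open>Meaningful only for graphs with finitely many vertices; the graph without
  vertices has clique number 0, because the empty set is a clique.\<close>

definition clique_number :: "'a mixed_graph \<Rightarrow> nat" where
  "clique_number G = Max (card ` {K. clique G K})"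

definition proper_coloring :: "'a mixed_graph \<Rightarrow> ('a \<Rightarrow> nat) \<Rightarrow> bool" where
  "proper_coloring G f \<longleftrightarrow>
     (\<forall>u v. {u, v} \<in> edges G \<longrightarrow> f u \<noteq> f v) \<and>
     (\<forall>u v. (u, v) \<in> arcs G \<longrightarrow> f u < f v)"

definition num_colors :: "'a mixed_graph \<Rightarrow> ('a \<Rightarrow> nat) \<Rightarrow> nat" where
  "num_colors G f = card (f ` verts G)"

definition containment_interval_graph :: "real set set \<Rightarrow> real set mixed_graph" where
  "containment_interval_graph I =
     \<lparr>verts = I,
      edges = {{u, v} | u v. u \<in> I \<and> v \<in> I \<and> u \<noteq> v \<and> u \<inter> v \<noteq> {}
                             \<and> \<not> u \<subseteq> v \<and> \<not> v \<subseteq> u},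
      arcs  = {(u, v). u \<in> I \<and> v \<in> I \<and> u \<noteq> v \<and> u \<inter> v \<noteq> {} \<and> v \<subseteq> u}\<rparr>"

end

theory Submission
  imports Defs
begin

text \<open>Induct on the largest number of intervals through a point, which is at most the clique
  number. Among the inclusion-maximal intervals choose a minimal subfamily \<open>R\<close> covering the union
  of all intervals. Of three intervals through a common point one is covered by the other two, so
  no point lies in three members of \<open>R\<close>, and hence \<open>R\<close> can be coloured with two colours. Removing
  \<open>R\<close> lowers the number of intervals through every covered point, so the remaining intervals can
  be coloured by induction. The two colours of \<open>R\<close> are placed below all others, which is
  consistent because no interval properly contains a member of \<open>R\<close>.\<close>

lemma card_le_clique_number:
  assumes "finite (verts G)" and "clique G K"
  shows "card K \<le> clique_number G"
proof -
  have "{K. clique G K} \<subseteq> Pow (verts G)"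
    by (auto simp: clique_def)
  then have "finite {K. clique G K}"
    using assms(1) by (meson finite_Pow_iff finite_subset)
  then show ?thesis
    using assms(2) unfolding clique_number_def by (intro Max_ge) auto
qed

text \<open>Intervals sharing a point are joined by an arc if nested and by an edge otherwise. With
  \<open>card_le_clique_number\<close> this bounds the depth at every point by the clique
  number.\<close>

lemma clique_intervals_through_point:
  "clique (containment_interval_graph I) {u \<in> I. x \<in> u}"
proof -
  let ?G = "containment_interval_graph I"
  have "{u, v} \<in> underlying_edges ?G" if "u \<in> I" "v \<in> I" "x \<in> u" "x \<in> v" "u \<noteq> v" for u v
  proof -
    have "u \<inter> v \<noteq> {}" using that by blast
    show ?thesis
    proof (cases "v \<subseteq> u \<or> u \<subseteq> v")
      case True
      then have "(u, v) \<in> arcs ?G \<or> (v, u) \<in> arcs ?G"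
        using that \<open>u \<inter> v \<noteq> {}\<close> unfolding containment_interval_graph_def by (simp add: Int_commute)
      then have "\<exists>a b. {u, v} = {a, b} \<and> (a, b) \<in> arcs ?G"
        using insert_commute[of u v "{}"] by metis
      then show ?thesis by (simp add: underlying_edges_def)
    next
      case False
      have "{u, v} \<in> edges ?G"
        using that \<open>u \<inter> v \<noteq> {}\<close> False unfolding containment_interval_graph_def
        by auto
      then show ?thesis by (simp add: underlying_edges_def)
    qed
  qed
  then show ?thesis
    by (simp add: clique_def containment_interval_graph_def)
qed

lemma clique_singleton:
  "v \<in> verts G \<Longrightarrow> clique G {v}"
  by (simp add: clique_def)

text \<open>Asking for distinct values on all intersecting pairs, nested ones included, costs
  nothing, since nested pairs receive strictly ordered values anyway.\<close>

lemma proper_coloring_containmentI: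
  assumes "\<And>u v. \<lbrakk>u \<in> I; v \<in> I; u \<noteq> v; u \<inter> v \<noteq> {}\<rbrakk> \<Longrightarrow> f u \<noteq> f v"
    and "\<And>u v. \<lbrakk>u \<in> I; v \<in> I; u \<noteq> v; u \<inter> v \<noteq> {}; v \<subseteq> u\<rbrakk> \<Longrightarrow> f u < f v"
  shows "proper_coloring (containment_interval_graph I) f"
proof -
  have "f u \<noteq> f v" if edge: "{u, v} \<in> edges (containment_interval_graph I)" for u v
  proof -
    obtain a b where "{u, v} = {a, b}" "a \<in> I" "b \<in> I" "a \<noteq> b" "a \<inter> b \<noteq> {}"
      using edge unfolding containment_interval_graph_def by auto
    then show ?thesis
      using assms(1)[of a b] by (auto simp: doubleton_eq_iff)
  qed
  then show ?thesis
    using assms(2) by (simp add: proper_coloring_def containment_interval_graph_def)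
qed

lemma proper_coloring_containmentD:
  assumes "proper_coloring (containment_interval_graph I) f"
    and "u \<in> I" "v \<in> I" "u \<noteq> v" "u \<inter> v \<noteq> {}"
  shows "f u \<noteq> f v" and "v \<subseteq> u \<Longrightarrow> f u < f v"
proof -
  have arc: "f u < f v" if "u \<in> I" "v \<in> I" "u \<noteq> v" "u \<inter> v \<noteq> {}" "v \<subseteq> u" for u v
    using assms(1) that by (auto simp: proper_coloring_def containment_interval_graph_def)
  then show "v \<subseteq> u \<Longrightarrow> f u < f v"
    using assms by blast
  show "f u \<noteq> f v"
  proof (cases "u \<subseteq> v \<or> v \<subseteq> u")
    case True
    then show ?thesis
      using arc[of u v] arc[of v u] assms(2-5) by (metis Int_commute less_irrefl)
  next
    case False
    then have "{u, v} \<in> edges (containment_interval_graph I)"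
      using assms(2-5) unfolding containment_interval_graph_def by simp blast
    then show ?thesis
      using assms(1) by (simp add: proper_coloring_def)
  qed
qed

text \<open>If each interval had a point outside the other two, two of these private points would
  lie on the same side of \<open>x\<close>. By convexity, the interval whose private point is
  farther from \<open>x\<close> would contain the nearer one.\<close>

lemma three_intervals_through_point:
  fixes a b c :: "real set"
  assumes "is_interval a" "is_interval b" "is_interval c" and "x \<in> a" "x \<in> b" "x \<in> c"
  shows "a \<subseteq> b \<union> c \<or> b \<subseteq> a \<union> c \<or> c \<subseteq> a \<union> b"
proof (rule ccontr)
  assume "\<not> ?thesis"
  then obtain p q r where pqr: "p \<in> a" "p \<notin> b" "p \<notin> c" "q \<in> b" "q \<notin> a" "q \<notin> c"
      "r \<in> c" "r \<notin> a" "r \<notin> b"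
    by blast
  have far: False if "is_interval s" "is_interval t" "x \<in> s" "x \<in> t" "y \<in> s" "y \<notin> t" "z \<in> t" "z \<notin> s"
      "y \<le> x \<and> z \<le> x \<or> x \<le> y \<and> x \<le> z" for s t and y z :: real
    using that by (metis linear mem_is_interval_1_I)
  show False
    using far[of a b p q] far[of a c p r] far[of b c q r] assms pqr by linarith
qed

text \<open>An interval that ends first on the right meets at most one other interval, because any
  two intervals meeting it would share a point of it.\<close>

lemma two_coloring_depth_two:
  fixes S :: "real set set"
  assumes "finite S" and "\<And>u. u \<in> S \<Longrightarrow> is_interval u"
    and "\<And>x a b c. \<lbrakk>a \<in> S; b \<in> S; c \<in> S; x \<in> a; x \<in> b; x \<in> c\<rbrakk> \<Longrightarrow> a = b \<or> a = c \<or> b = c"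
  shows "\<exists>c :: real set \<Rightarrow> nat. range c \<subseteq> {..<2} \<and>
           (\<forall>u\<in>S. \<forall>v\<in>S. u \<noteq> v \<longrightarrow> u \<inter> v \<noteq> {} \<longrightarrow> c u \<noteq> c v)"
  using assms
proof (induction S rule: finite_psubset_induct)
  case (psubset S)
  show ?case
  proof (cases "S = {}")
    case True
    then show ?thesis by (intro exI[of _ "\<lambda>_. 0"]) auto
  next
    case False
    \<comment> \<open>Down-closures compare right ends without naming endpoints, so open, closed and
      unbounded intervals are treated alike. They form a chain, so a minimal one is least.\<close>
    define D where "D u = {x. \<exists>y\<in>u. x \<le> y}" for u :: "real set"
    have "\<exists>m \<in> D ` S. \<forall>b \<in> D ` S. b \<le> m \<longrightarrow> m = b"
      using psubset.hyps False by (intro finite_has_minimal) auto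
    then obtain u where u: "u \<in> S" and min: "\<And>v. v \<in> S \<Longrightarrow> D v \<subseteq> D u \<Longrightarrow> D u = D v"
      by auto
    have chain: "D v \<subseteq> D w \<or> D w \<subseteq> D v" for v w
      unfolding D_def by (smt (verit, best) mem_Collect_eq subsetI)
    have le: "D u \<subseteq> D v" if "v \<in> S" for v
      using chain[of u v] min[OF that] by blast
    \<comment> \<open>Since \<open>u\<close> ends first, \<open>v\<close> reaches \<open>z\<close>
      or beyond; convexity then puts \<open>z\<close> in \<open>v\<close>.\<close>
    have common: "z \<in> v" if "v \<in> S" "y \<in> u" "y \<in> v" "z \<in> u" "y \<le> z" for v y z
    proof -
      have "z \<in> D v" using le[OF \<open>v \<in> S\<close>] \<open>z \<in> u\<close> by (auto simp: D_def)
      then obtain t where "t \<in> v" "z \<le> t" by (auto simp: D_def)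
      then show ?thesis
        using psubset.prems(1)[OF \<open>v \<in> S\<close>] that by (meson mem_is_interval_1_I)
    qed
    \<comment> \<open>The larger of a point of \<open>u\<close> and \<open>v\<close> and a point of
      \<open>u\<close> and \<open>w\<close> lies in all three intervals, so depth two forces
      \<open>v = w\<close>.\<close>
    have uniq: "v = w" if vw: "v \<in> S - {u}" "w \<in> S - {u}" "u \<inter> v \<noteq> {}" "u \<inter> w \<noteq> {}" for v w
    proof -
      obtain y z where yz: "y \<in> u" "y \<in> v" "z \<in> u" "z \<in> w" using vw by blast
      have "\<exists>x. x \<in> u \<and> x \<in> v \<and> x \<in> w"
        using common[of v y z] common[of w z y] yz vw by (cases "y \<le> z") auto
      then show ?thesis using psubset.prems(2)[of u v w] u vw by blast
    qed
    have "\<exists>c :: real set \<Rightarrow> nat. range c \<subseteq> {..<2} \<and>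
           (\<forall>v\<in>S - {u}. \<forall>w\<in>S - {u}. v \<noteq> w \<longrightarrow> v \<inter> w \<noteq> {} \<longrightarrow> c v \<noteq> c w)"
    proof (rule psubset.IH)
      show "S - {u} \<subset> S" using u by blast
      show "is_interval v" if "v \<in> S - {u}" for v
        using psubset.prems(1) that by blast
      show "a = b \<or> a = c \<or> b = c"
        if "a \<in> S - {u}" "b \<in> S - {u}" "c \<in> S - {u}" "x \<in> a" "x \<in> b" "x \<in> c" for x a b c
        using psubset.prems(2)[of a b c x] that by blast
    qed
    then obtain c :: "real set \<Rightarrow> nat" where c: "range c \<subseteq> {..<2}"
      "\<And>v w. \<lbrakk>v \<in> S - {u}; w \<in> S - {u}; v \<noteq> w; v \<inter> w \<noteq> {}\<rbrakk> \<Longrightarrow> c v \<noteq> c w"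
      by metis
    obtain k :: nat where k: "k < 2" "\<And>v. \<lbrakk>v \<in> S - {u}; u \<inter> v \<noteq> {}\<rbrakk> \<Longrightarrow> c v \<noteq> k"
    proof (cases "\<exists>v \<in> S - {u}. u \<inter> v \<noteq> {}")
      case True
      then obtain v where v: "v \<in> S - {u}" "u \<inter> v \<noteq> {}" by blast
      have "c v < 2" using c(1) by blast
      \<comment> \<open>\<open>1 - c v\<close> is the other of the two colours; it is free because
        \<open>v\<close> is the only neighbour of \<open>u\<close>.\<close>
      then have "1 - c v < 2" "c v \<noteq> 1 - c v" by presburger+
      then show ?thesis using that[of "1 - c v"] uniq[OF v(1) _ v(2)] by blast
    next
      case False
      then show ?thesis using that[of 0] by auto
    qed
    have "range (c(u := k)) \<subseteq> {..<2}"
      using c(1) k(1) by (auto simp: fun_upd_def)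
    moreover have "(c(u := k)) v \<noteq> (c(u := k)) w"
      if "v \<in> S" "w \<in> S" "v \<noteq> w" "v \<inter> w \<noteq> {}" for v w
      using that c(2)[of v w] k(2)[of v] k(2)[of w] by (auto simp: Int_commute)
    ultimately show ?thesis by blast
  qed
qed

lemma two_colorable_maximal_cover:
  fixes I :: "real set set"
  assumes "finite I" and "\<And>u. u \<in> I \<Longrightarrow> is_interval u"
  obtains R and c :: "real set \<Rightarrow> nat" where "R \<subseteq> I" "\<Union>R = \<Union>I" "range c \<subseteq> {..<2}"
    "\<And>u v. \<lbrakk>u \<in> R; v \<in> I; u \<subseteq> v\<rbrakk> \<Longrightarrow> u = v"
    "\<And>u v. \<lbrakk>u \<in> R; v \<in> R; u \<noteq> v; u \<inter> v \<noteq> {}\<rbrakk> \<Longrightarrow> c u \<noteq> c v"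
proof -
  define M where "M = {u \<in> I. \<forall>v\<in>I. u \<subseteq> v \<longrightarrow> u = v}"
  have "\<Union>M = \<Union>I"
  proof
    show "\<Union>I \<subseteq> \<Union>M"
    proof
      fix x assume "x \<in> \<Union>I"
      then obtain u where "u \<in> I" "x \<in> u" by blast
      then obtain m where "m \<in> I" "u \<subseteq> m" "\<forall>v\<in>I. m \<subseteq> v \<longrightarrow> m = v"
        using finite_has_maximal2[OF assms(1)] by metis
      then show "x \<in> \<Union>M" using \<open>x \<in> u\<close> by (auto simp: M_def)
    qed
  qed (auto simp: M_def)
  define \<C> where "\<C> = {R. R \<subseteq> M \<and> \<Union>R = \<Union>I}"
  have "finite M" using assms(1) by (simp add: M_def)
  then have "finite \<C>" by (simp add: \<C>_def)
  moreover have "M \<in> \<C>" using \<open>\<Union>M = \<Union>I\<close> by (simp add: \<C>_def)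
  ultimately obtain R where R: "R \<in> \<C>" and min: "\<And>Q. Q \<in> \<C> \<Longrightarrow> Q \<subseteq> R \<Longrightarrow> R = Q"
    using finite_has_minimal[of \<C>] by blast
  have RI: "R \<subseteq> I" using R by (auto simp: \<C>_def M_def)
  \<comment> \<open>Otherwise deleting \<open>a\<close> would leave a smaller cover, against the
    minimality of \<open>R\<close>.\<close>
  have irred: "\<not> a \<subseteq> b \<union> c" if "a \<in> R" "b \<in> R" "c \<in> R" "a \<noteq> b" "a \<noteq> c" for a b c
  proof
    assume "a \<subseteq> b \<union> c"
    then have "\<Union>(R - {a}) = \<Union>R" using that by blast
    then have "R - {a} \<in> \<C>" using R by (auto simp: \<C>_def)
    then show False using min \<open>a \<in> R\<close> by blast
  qed
  have "\<exists>c :: real set \<Rightarrow> nat. range c \<subseteq> {..<2} \<and>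
           (\<forall>u\<in>R. \<forall>v\<in>R. u \<noteq> v \<longrightarrow> u \<inter> v \<noteq> {} \<longrightarrow> c u \<noteq> c v)"
  proof (rule two_coloring_depth_two)
    show "finite R" using RI assms(1) finite_subset by blast
    show "is_interval u" if "u \<in> R" for u using assms(2) RI that by blast
    show "a = b \<or> a = c \<or> b = c"
      if "a \<in> R" "b \<in> R" "c \<in> R" "x \<in> a" "x \<in> b" "x \<in> c" for x a b c
      using three_intervals_through_point[of a b c x] irred[of a b c] irred[of b a c] irred[of c a b]
        assms(2) RI that by blast
  qed
  then obtain c :: "real set \<Rightarrow> nat" where "range c \<subseteq> {..<2}"
    "\<forall>u\<in>R. \<forall>v\<in>R. u \<noteq> v \<longrightarrow> u \<inter> v \<noteq> {} \<longrightarrow> c u \<noteq> c v" by blast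
  moreover have "u = v" if "u \<in> R" "v \<in> I" "u \<subseteq> v" for u v
    using R that by (auto simp: \<C>_def M_def)
  ultimately show ?thesis
    using that[of R c] RI R by (auto simp: \<C>_def)
qed

text \<open>The depth bound is \<open>Suc k\<close> so that the induction starts at depth one, where
  distinct intervals are disjoint and one colour suffices. Each further level costs two
  colours.\<close>

lemma containment_coloring_of_depth:
  fixes I :: "real set set"
  assumes "finite I" and "\<And>u. u \<in> I \<Longrightarrow> is_interval u"
    and "\<And>x. card {u \<in> I. x \<in> u} \<le> Suc k"
  shows "\<exists>f. proper_coloring (containment_interval_graph I) f \<and> f ` I \<subseteq> {..<2 * k + 1}"
  using assms
proof (induction k arbitrary: I)
  case 0
  have "u = v" if "u \<in> I" "v \<in> I" "x \<in> u" "x \<in> v" for u v x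
    using 0(1) 0(3)[of x] that by (auto simp: card_le_Suc0_iff_eq)
  then have "proper_coloring (containment_interval_graph I) (\<lambda>_. 0)"
    by (intro proper_coloring_containmentI) blast+
  then show ?case by auto
next
  case (Suc k)
  obtain R and c :: "real set \<Rightarrow> nat" where R: "R \<subseteq> I" "\<Union>R = \<Union>I" and c2: "range c \<subseteq> {..<2}"
    and max: "\<And>u v. \<lbrakk>u \<in> R; v \<in> I; u \<subseteq> v\<rbrakk> \<Longrightarrow> u = v"
    and c: "\<And>u v. \<lbrakk>u \<in> R; v \<in> R; u \<noteq> v; u \<inter> v \<noteq> {}\<rbrakk> \<Longrightarrow> c u \<noteq> c v"
    using two_colorable_maximal_cover[OF Suc.prems(1,2)] by metis
  have depth: "card {u \<in> I - R. x \<in> u} \<le> Suc k" for x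
  proof (cases "x \<in> \<Union>I")
    case True
    then obtain r where "r \<in> R" "x \<in> r" using R(2) by blast
    then have "{u \<in> I - R. x \<in> u} \<subset> {u \<in> I. x \<in> u}" using R(1) by blast
    then have "card {u \<in> I - R. x \<in> u} < card {u \<in> I. x \<in> u}"
      using Suc.prems(1) by (intro psubset_card_mono) auto
    then show ?thesis using Suc.prems(3)[of x] by linarith
  next
    \<comment> \<open>Outside the union the depth does not drop, but it is already zero.\<close>
    case False
    then have "{u \<in> I - R. x \<in> u} = {}" by blast
    then show ?thesis by (simp only: card.empty)
  qed
  obtain f where f: "proper_coloring (containment_interval_graph (I - R)) f"
    and fk: "f ` (I - R) \<subseteq> {..<2 * k + 1}"
    using Suc.IH[of "I - R"] Suc.prems(1,2) depth by auto
  note fD = proper_coloring_containmentD[OF f]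
  \<comment> \<open>The shift by 2 reserves the colours 0 and 1 for \<open>R\<close>.\<close>
  define g where "g u = (if u \<in> R then c u else f u + 2)" for u
  have cl: "c u < 2" for u using c2 by blast
  have "proper_coloring (containment_interval_graph I) g"
  proof (rule proper_coloring_containmentI)
    fix u v assume uv: "u \<in> I" "v \<in> I" "u \<noteq> v" "u \<inter> v \<noteq> {}"
    show "g u \<noteq> g v"
      using uv c[of u v] fD(1)[of u v] cl[of u] cl[of v] by (auto simp: g_def)
    show "g u < g v" if "v \<subseteq> u"
    proof -
      \<comment> \<open>The contained interval is not maximal, so its colour is a shifted one. The
        containing interval either lies in \<open>R\<close> and has a colour below 2, or the order
        is inherited from \<open>f\<close>.\<close>
      have "v \<notin> R" using max[of v u] uv that by blast
      then show ?thesis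
        using uv fD(2)[of u v] cl[of u] that by (auto simp: g_def)
    qed
  qed
  moreover have "g ` I \<subseteq> {..<2 * Suc k + 1}"
  proof
    fix y assume "y \<in> g ` I"
    then obtain u where u: "u \<in> I" "y = g u" by blast
    show "y \<in> {..<2 * Suc k + 1}"
    proof (cases "u \<in> R")
      case True
      then show ?thesis using u cl[of u] by (simp add: g_def)
    next
      case False
      then have "f u < 2 * k + 1" using u fk by blast
      then show ?thesis using u False by (simp add: g_def)
    qed
  qed
  ultimately show ?case by blast
qed

theorem theorem2:
  fixes I :: "real set set"
  assumes "finite I"
    and "\<And>u. u \<in> I \<Longrightarrow> is_interval u"
  shows "\<exists>f. proper_coloring (containment_interval_graph I) f \<and>
             num_colors (containment_interval_graph I) f
               \<le> 2 * clique_number (containment_interval_graph I) - 1"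
proof -
  let ?G = "containment_interval_graph I"
  have verts: "verts ?G = I" by (simp add: containment_interval_graph_def)
  show ?thesis
  proof (cases "I = {}")
    \<comment> \<open>Here the truncated subtraction makes the bound at least 0, and no colour is
      used.\<close>
    case True
    then have "proper_coloring ?G (\<lambda>_. 0)"
      by (intro proper_coloring_containmentI) auto
    then show ?thesis using True verts by (auto simp: num_colors_def)
  next
    case False
    then obtain v where "v \<in> I" by blast
    \<comment> \<open>Positivity lets the clique number be written as \<open>Suc k\<close>, which
      turns the bound into \<open>2 * k + 1\<close>.\<close>
    then have "1 \<le> clique_number ?G"
      using card_le_clique_number[OF _ clique_singleton[of v ?G]] assms(1) verts by simp
    then obtain k where k: "clique_number ?G = Suc k"
      using not0_implies_Suc by fastforce
    have "card {u \<in> I. x \<in> u} \<le> Suc k" for x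
      using card_le_clique_number[OF _ clique_intervals_through_point[of I x]] assms(1) verts k by simp
    then obtain f where f: "proper_coloring ?G f" "f ` I \<subseteq> {..<2 * k + 1}"
      using containment_coloring_of_depth[OF assms] by blast
    have "card (f ` I) \<le> card {..<2 * k + 1}"
      using f(2) by (intro card_mono) auto
    then show ?thesis using f(1) k verts by (auto simp: num_colors_def)
  qed
qed

end
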